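(* Let $E_1$ and $E_2$ be systems of relations over $S^{\pm}$ and $T^{\pm}$ respectively, where $S$ and $T$ are (possibly different) finite alphabets, such that the groups $\Gamma(E_1)$ and $\Gamma(E_2)$ are isomorphic. Then $E_1$ is testable if and only if $E_2$ is testable.
   Context: Words and relations. For a finite alphabet $S$, $S^{-}$ is its set of formal inverses, $S^{\pm}=S\cup S^{-}$, and $F_S$ is the free group on $S$. A system of relations $E=\{w_{i,1}=w_{i,2}\}_{i=1}^r$ over $S^{\pm}$ is a finite set of formal equations between words over $S^{\pm}$. $\Gamma(E)=\langle S\mid E\rangle$ is the finitely presented group generated by $S$ subject to the relations $E$, i.e. the quotient of $F_S$ by the normal closure of $\{w_{i,2}^{-1}w_{i,1}\}_{i=1}^r$. $S$-graphs. An $S$-graph is a directed graph (self-loops and multiple edges allowed) with edges labelled by elements of $S$, such that for each $s\in S$ every vertex has exactly one outgoing and exactly one incoming edge labelled $s$. $s_Gx$ is the endpoint of the $s$-labelled edge leaving $x$, $s_G^{-1}x$ the origin of the $s$-labelled edge entering $x$; for a word $w=w_t\cdots w_1$ ($w_i\in S^{\pm}$), $w_Gx=(w_t)_G(\cdots((w_1)_Gx))$. $\mathcal G_S(n)$ is the set of $S$-graphs with vertex set $[n]=\{1,\dots,n\}$ (equivalently, $|S|$-tuples of permutations of $[n]$). $\mathrm{GSol}_E(n)$ is the set of $G\in\mathcal G_S(n)$ with $(w_{i,1})_Gx=(w_{i,2})_Gx$ for all $i$ and all $x\in[n]$. For $G,G'\in\mathcal G_S(n)$, $d^{\mathrm H}(G,G')=\sum_{s\in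 S}\frac1n|\{x\in[n]: s_Gx\ne s_{G'}x\}|$, and for $\varepsilon>0$, $\mathrm{GSol}_E^{\ge\varepsilon}(n)=\{G\in\mathcal G_S(n): d^{\mathrm H}(G,G')\ge\varepsilon\ \forall G'\in\mathrm{GSol}_E(n)\}$. Testability. A (randomized, adaptive) algorithm that takes $n\in\mathbb N$ and has query access to $G\in\mathcal G_S(n)$ is an $(\varepsilon,q)$-tester for $E$ if: it accepts with probability at least $0.99$ whenever $G\in\mathrm{GSol}_E(n)$; it rejects with probability at least $0.99$ whenever $G\in\mathrm{GSol}_E^{\ge\varepsilon}(n)$; and it makes at most $q$ queries, each of the form "what is $s_Gx$?" with $x\in[n]$, $s\in S^{\pm}$. Running time is not restricted. $E$ is testable if for every $\varepsilon>0$ there are $q=q(\varepsilon)\in\mathbb N$ (independent of $n$) and an $(\varepsilon,q)$-tester for $E$. The definitions for $T$ are the same with $T$ in place of $S$. *)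

theory Defs
  imports
    "HOL-Algebra.Coset"
    "HOL-Combinatorics.Permutations"
    "HOL-Library.FuncSet"
    "HOL-Probability.Probability_Mass_Function"
begin

subsection \<open>Words and systems of relations\<close>

datatype 'a letter = Pos 'a | Neg 'a

definition signed :: "'a set \<Rightarrow> 'a letter set" where
  "signed S = Pos ` S \<union> Neg ` S"

text \<open>The word \<open>w\<^sub>t \<cdots> w\<^sub>1\<close> is the list \<open>[w\<^sub>t, \<dots>, w\<^sub>1]\<close>, in the same left-to-right order.\<close>

type_synonym 'a word = "'a letter list"

type_synonym 'a relsys = "('a word \<times> 'a word) set"

definition relation_system :: "'a set \<Rightarrow> 'a relsys \<Rightarrow> bool" where
  "relation_system S E \<longleftrightarrow> finite E \<and> E \<subseteq> lists (signed S) \<times> lists (signed S)"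

fun inv_letter :: "'a letter \<Rightarrow> 'a letter" where
  "inv_letter (Pos s) = Neg s"
| "inv_letter (Neg s) = Pos s"

definition inv_word :: "'a word \<Rightarrow> 'a word" where
  "inv_word w = rev (map inv_letter w)"

subsection \<open>Free groups and finitely presented groups\<close>

text \<open>If \<open>v\<close> is freely reduced, \<open>cons_reduced a v\<close> is the free reduction of \<open>a # v\<close>.\<close>

definition cons_reduced :: "'a letter \<Rightarrow> 'a word \<Rightarrow> 'a word" where
  "cons_reduced a v =
     (case v of [] \<Rightarrow> [a] | b # v' \<Rightarrow> if b = inv_letter a then v' else a # v)"

definition reduce :: "'a word \<Rightarrow> 'a word" where
  "reduce w = foldr cons_reduced w []"

definition free_group :: "'a set \<Rightarrow> 'a word monoid" where
  "free_group S =
     \<lparr> carrier = {w \<in> lists (signed S). reduce w = w},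
       monoid.mult = (\<lambda>u v. reduce (u @ v)),
       monoid.one = [] \<rparr>"

text \<open>The following facts culminate in \<open>group_free_group\<close>: reduced words with reduced
  concatenation do form a group.\<close>

lemma inv_letter_invol [simp]: "inv_letter (inv_letter a) = a"
  by (cases a) auto

lemma cons_reduced_fixed:
  assumes "reduce v = v" shows "reduce (cons_reduced a v) = cons_reduced a v"
proof (cases v)
  case Nil then show ?thesis by (simp add: cons_reduced_def reduce_def)
next
  case (Cons b v')
  have v: "cons_reduced b (reduce v') = b # v'"
    using assms Cons by (simp add: reduce_def)
  have "reduce v' = v'"
  proof (cases "reduce v'")
    case Nil then show ?thesis using v by (simp add: cons_reduced_def)
  next
    case (Cons c u)
    show ?thesis
    proof (cases "c = inv_letter b")
      case True
      have "length (reduce w) \<le> length w" for w :: "'a word"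
        by (induction w)
          (auto simp: reduce_def cons_reduced_def split: list.splits)
      from this[of v'] show ?thesis using v Cons True by (simp add: cons_reduced_def)
    next
      case False then show ?thesis using v Cons by (simp add: cons_reduced_def)
    qed
  qed
  then show ?thesis using assms Cons
    by (auto simp: cons_reduced_def reduce_def)
qed

lemma reduce_Cons [simp]: "reduce (a # w) = cons_reduced a (reduce w)"
  by (simp add: reduce_def)

lemma reduce_Nil [simp]: "reduce [] = []"
  by (simp add: reduce_def)

lemma reduce_idem [simp]: "reduce (reduce w) = reduce w"
  by (induction w) (simp_all add: cons_reduced_fixed)

lemma cons_reduced_inv:
  assumes "reduce v = v" shows "cons_reduced a (cons_reduced (inv_letter a) v) = v"
proof (cases v)
  case Nil then show ?thesis by (simp add: cons_reduced_def)
next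
  case (Cons b v')
  show ?thesis
  proof (cases "b = a")
    case True
    have "reduce (tl v) = tl v \<and> (tl v = [] \<or> hd (tl v) \<noteq> inv_letter a)"
    proof -
      have eq: "cons_reduced a (reduce v') = a # v'" using assms Cons True by simp
      have len: "length (reduce w) \<le> length w" for w :: "'a word"
        by (induction w) (auto simp: cons_reduced_def split: list.splits)
      show ?thesis using eq len[of v'] Cons
        by (auto simp: cons_reduced_def split: list.splits if_splits)
    qed
    then show ?thesis using Cons True by (auto simp: cons_reduced_def split: list.splits)
  next
    case False
    then show ?thesis using Cons by (simp add: cons_reduced_def)
  qed
qed

lemma foldr_cons_reduced_fixed:
  "reduce v = v \<Longrightarrow> reduce (foldr cons_reduced u v) = foldr cons_reduced u v"
  by (induction u) (simp_all add: cons_reduced_fixed)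

lemma foldr_cons_reduced_step:
  assumes "reduce v = v"
  shows "foldr cons_reduced (cons_reduced a u) v = cons_reduced a (foldr cons_reduced u v)"
proof (cases u)
  case (Cons b u')
  have "cons_reduced a (b # u') = (if b = inv_letter a then u' else a # b # u')"
    by (simp add: cons_reduced_def)
  then show ?thesis
    using Cons cons_reduced_inv[OF foldr_cons_reduced_fixed[OF assms, of u'], of a]
    by (cases "b = inv_letter a") simp_all
qed (simp add: cons_reduced_def)

lemma foldr_reduce:
  "reduce v = v \<Longrightarrow> foldr cons_reduced (reduce u) v = foldr cons_reduced u v"
  by (induction u) (simp_all add: foldr_cons_reduced_step)

lemma reduce_append: "reduce (u @ v) = foldr cons_reduced u (reduce v)"
  by (simp add: reduce_def)

lemma reduce_append_left [simp]: "reduce (reduce u @ v) = reduce (u @ v)"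
  by (simp add: reduce_append foldr_reduce)

lemma reduce_append_right [simp]: "reduce (u @ reduce v) = reduce (u @ v)"
  by (simp add: reduce_append)

lemma reduce_inv_word: "reduce (inv_word w @ w) = []"
proof (induction w)
  case (Cons a w)
  have "foldr cons_reduced [inv_letter a] (reduce (a # w)) = reduce w"
    using cons_reduced_inv[of "reduce w" "inv_letter a"] by simp
  then show ?case using Cons by (simp add: inv_word_def reduce_append)
qed (simp add: inv_word_def)

lemma signed_inv_letter: "a \<in> signed S \<Longrightarrow> inv_letter a \<in> signed S"
  by (auto simp: signed_def)

lemma reduce_in_lists: "w \<in> lists (signed S) \<Longrightarrow> reduce w \<in> lists (signed S)"
  by (induction w) (auto simp: cons_reduced_def split: list.splits)

lemma inv_word_in_lists: "w \<in> lists (signed S) \<Longrightarrow> inv_word w \<in> lists (signed S)"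
  by (auto simp: inv_word_def signed_inv_letter)

lemma group_free_group: "group (free_group S)"
proof (rule groupI)
  fix x y z
  assume "x \<in> carrier (free_group S)" "y \<in> carrier (free_group S)" "z \<in> carrier (free_group S)"
  then show "x \<otimes>\<^bsub>free_group S\<^esub> y \<otimes>\<^bsub>free_group S\<^esub> z
      = x \<otimes>\<^bsub>free_group S\<^esub> (y \<otimes>\<^bsub>free_group S\<^esub> z)"
    by (simp add: free_group_def)
next
  fix x assume x: "x \<in> carrier (free_group S)"
  show "\<exists>y\<in>carrier (free_group S). y \<otimes>\<^bsub>free_group S\<^esub> x = \<one>\<^bsub>free_group S\<^esub>"
    using x inv_word_in_lists[of x S] reduce_in_lists[of "inv_word x" S] reduce_inv_word[of x]
    by (intro bexI[of _ "reduce (inv_word x)"]) (auto simp: free_group_def)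
qed (auto simp: free_group_def intro!: reduce_in_lists simp flip: in_lists_conv_set)

definition normal_closure :: "('a, 'b) monoid_scheme \<Rightarrow> 'a set \<Rightarrow> 'a set" where
  "normal_closure G R = \<Inter> {N. N \<lhd> G \<and> R \<subseteq> N}"

definition relators :: "'a relsys \<Rightarrow> 'a word set" where
  "relators E = (\<lambda>(w1, w2). reduce (inv_word w2 @ w1)) ` E"

definition presented_group :: "'a set \<Rightarrow> 'a relsys \<Rightarrow> 'a word set monoid" where
  "presented_group S E = free_group S Mod normal_closure (free_group S) (relators E)"

subsection \<open>Labelled graphs on \<open>{1..n}\<close> as tuples of permutations\<close>

text \<open>\<open>G s x\<close> is the endpoint of the \<open>s\<close>-labelled edge leaving \<open>x\<close>. For each label, having
  exactly one outgoing and one incoming edge at every vertex makes \<open>G s\<close> a permutation of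
  \<open>{1..n}\<close>. Values outside \<open>S\<close> and \<open>{1..n}\<close> are normalised by \<open>\<rightarrow>\<^sub>E\<close> and \<open>permutes\<close>.\<close>

type_synonym 'a sgraph = "'a \<Rightarrow> nat \<Rightarrow> nat"

definition sgraphs :: "'a set \<Rightarrow> nat \<Rightarrow> 'a sgraph set" where
  "sgraphs S n = S \<rightarrow>\<^sub>E {p. p permutes {1..n}}"

fun letter_act :: "'a sgraph \<Rightarrow> 'a letter \<Rightarrow> nat \<Rightarrow> nat" where
  "letter_act G (Pos s) x = G s x"
| "letter_act G (Neg s) x = inv_into UNIV (G s) x"

definition word_act :: "'a sgraph \<Rightarrow> 'a word \<Rightarrow> nat \<Rightarrow> nat" where
  "word_act G w x = foldr (letter_act G) w x"

definition GSol :: "'a set \<Rightarrow> 'a relsys \<Rightarrow> nat \<Rightarrow> 'a sgraph set" where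
  "GSol S E n =
     {G \<in> sgraphs S n. \<forall>(w1, w2)\<in>E. \<forall>x\<in>{1..n}. word_act G w1 x = word_act G w2 x}"

definition hamming_dist :: "'a set \<Rightarrow> nat \<Rightarrow> 'a sgraph \<Rightarrow> 'a sgraph \<Rightarrow> real" where
  "hamming_dist S n G G' = (\<Sum>s\<in>S. 1 / real n * real (card {x \<in> {1..n}. G s x \<noteq> G' s x}))"

definition GSol_far :: "'a set \<Rightarrow> 'a relsys \<Rightarrow> real \<Rightarrow> nat \<Rightarrow> 'a sgraph set" where
  "GSol_far S E \<epsilon> n = {G \<in> sgraphs S n. \<forall>G'\<in>GSol S E n. hamming_dist S n G G' \<ge> \<epsilon>}"

subsection \<open>Randomized adaptive testers\<close>

text \<open>A deterministic adaptive query algorithm is a decision tree: \<open>Query a x k\<close> asks for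
  \<open>letter_act G a x\<close> and continues as \<open>k y\<close> on the answer \<open>y\<close>; \<open>Decide True\<close> accepts.
  A randomized algorithm is a map from the input \<open>n\<close> to a probability distribution over such
  trees (all coins are tossed in advance). No computability or running time bound is imposed.\<close>

datatype 'a dtree = Decide bool | Query "'a letter" nat "nat \<Rightarrow> 'a dtree"

primrec accepts :: "'a sgraph \<Rightarrow> 'a dtree \<Rightarrow> bool" where
  "accepts G (Decide b) = b"
| "accepts G (Query a x k) = accepts G (k (letter_act G a x))"

primrec queries :: "'a sgraph \<Rightarrow> 'a dtree \<Rightarrow> ('a letter \<times> nat) list" where
  "queries G (Decide b) = []"
| "queries G (Query a x k) = (a, x) # queries G (k (letter_act G a x))"

type_synonym 'a algorithm = "nat \<Rightarrow> 'a dtree pmf"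

definition is_tester :: "'a set \<Rightarrow> 'a relsys \<Rightarrow> real \<Rightarrow> nat \<Rightarrow> 'a algorithm \<Rightarrow> bool" where
  "is_tester S E \<epsilon> q A \<longleftrightarrow>
     (\<forall>n\<ge>1.
        (\<forall>G\<in>GSol S E n. measure_pmf.prob (A n) {t. accepts G t} \<ge> 99/100) \<and>
        (\<forall>G\<in>GSol_far S E \<epsilon> n. measure_pmf.prob (A n) {t. \<not> accepts G t} \<ge> 99/100) \<and>
        (\<forall>G\<in>sgraphs S n. \<forall>t\<in>set_pmf (A n).
           length (queries G t) \<le> q \<and> set (queries G t) \<subseteq> signed S \<times> {1..n}))"

definition testable :: "'a set \<Rightarrow> 'a relsys \<Rightarrow> bool" where
  "testable S E \<longleftrightarrow> (\<forall>\<epsilon>>0. \<exists>q A. is_tester S E \<epsilon> q A)"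

end

theory Submission
  imports Defs "HOL-Algebra.Sym_Groups" "HOL-Probability.Product_PMF"
begin

text \<open>An isomorphism lets one rewrite the generators on each side as words in the generators of the
  other side. A graph \<open>G\<close> labelled by \<open>T\<close> thus induces a graph \<open>H\<close> labelled by \<open>S\<close>, and a query
  to \<open>H\<close> costs boundedly many queries to \<open>G\<close>. To test \<open>G\<close> for \<open>E2\<close>, run the tester for \<open>E1\<close> on
  \<open>H\<close> and also check at random vertices that rewriting a generator of \<open>T\<close> forth and back does not
  change its action on \<open>G\<close>. A solution always passes this check. If \<open>G\<close> is far from all
  solutions, then either \<open>H\<close> is far from all solutions of \<open>E1\<close>, or \<open>H\<close> is close to a solution
  \<open>H'\<close>; in the second case the graph induced by \<open>H'\<close> solves \<open>E2\<close> and is close to the graph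
  induced by \<open>H\<close>, which must then differ from \<open>G\<close> at many vertices. In either case a single one of
  the two tests already rejects with probability \<open>0.99\<close>, so no amplification is needed.\<close>

declare One_nat_def [simp del] in_listsI [rule del] in_listsD [rule del]

subsection \<open>Actions of words\<close>

lemma word_act_Nil [simp]: "word_act G [] = id"
  by (simp add: word_act_def fun_eq_iff)

lemma word_act_Cons [simp]: "word_act G (a # w) = letter_act G a \<circ> word_act G w"
  by (simp add: word_act_def fun_eq_iff)

lemma word_act_append: "word_act G (u @ w) = word_act G u \<circ> word_act G w"
  by (induction u) (simp_all add: comp_assoc)

lemma letter_act_Pos: "letter_act G (Pos s) = G s"
  and letter_act_Neg: "letter_act G (Neg s) = inv' (G s)"
  by (simp_all add: fun_eq_iff)

lemma sgraphs_permutes: "G \<in> sgraphs S n \<Longrightarrow> s \<in> S \<Longrightarrow> G s permutes {1..n}"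
  by (auto simp: sgraphs_def)

lemma letter_act_permutes:
  assumes "G \<in> sgraphs S n" "a \<in> signed S"
  shows "letter_act G a permutes {1..n}"
  using assms(2) sgraphs_permutes[OF assms(1)] permutes_inv[OF sgraphs_permutes[OF assms(1)]]
  by (auto simp: signed_def letter_act_Pos letter_act_Neg)

lemma word_act_permutes:
  assumes "G \<in> sgraphs S n" "w \<in> lists (signed S)"
  shows "word_act G w permutes {1..n}"
  using assms(2)
proof induction
  case Nil
  then show ?case by (simp only: word_act_Nil permutes_id)
next
  case (Cons a w)
  then show ?case
    using permutes_compose[OF _ letter_act_permutes[OF assms(1)]] by (simp only: word_act_Cons)
qed

lemma letter_act_inv_letter:
  assumes "G \<in> sgraphs S n" "a \<in> signed S"
  shows "letter_act G (inv_letter a) = inv' (letter_act G a)"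
proof (cases a)
  case (Pos s)
  then show ?thesis by (simp add: letter_act_Pos letter_act_Neg)
next
  case (Neg s)
  then have "G s permutes {1..n}" using assms sgraphs_permutes[of G S n] by (auto simp: signed_def)
  with Neg show ?thesis by (simp add: letter_act_Pos letter_act_Neg permutes_inv_inv)
qed

lemma word_act_inv_word:
  assumes "G \<in> sgraphs S n" "w \<in> lists (signed S)"
  shows "word_act G (inv_word w) = inv' (word_act G w)"
  using assms(2)
proof induction
  case Nil
  then show ?case by (simp add: inv_word_def)
next
  case (Cons a w)
  have "word_act G (inv_word (a # w)) = word_act G (inv_word w) \<circ> letter_act G (inv_letter a)"
    by (simp add: inv_word_def word_act_append)
  also have "\<dots> = inv' (word_act G w) \<circ> inv' (letter_act G a)"
    using Cons assms(1) by (simp add: letter_act_inv_letter)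
  also have "\<dots> = inv' (word_act G (a # w))"
    using Cons letter_act_permutes[OF assms(1), of a] word_act_permutes[OF assms(1), of w]
    by (simp add: o_inv_distrib permutes_bij)
  finally show ?case .
qed

text \<open>If \<open>a\<close> cancels against the head of \<open>w\<close>, the deleted pair acts
  as a permutation composed with its inverse. Hence free reduction does not affect actions.\<close>

lemma word_act_cons_reduced:
  assumes "G \<in> sgraphs S n" "a \<in> signed S"
  shows "word_act G (cons_reduced a w) = letter_act G a \<circ> word_act G w"
proof -
  have "letter_act G a \<circ> letter_act G (inv_letter a) = id"
    using letter_act_permutes[OF assms] by (simp add: letter_act_inv_letter[OF assms] permutes_inv_o)
  then show ?thesis
    by (auto simp: cons_reduced_def comp_assoc[symmetric] split: list.splits)
qed

lemma word_act_reduce: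
  assumes "G \<in> sgraphs S n" "w \<in> lists (signed S)"
  shows "word_act G (reduce w) = word_act G w"
  using assms(2) by induction (simp_all add: word_act_cons_reduced[OF assms(1)])

text \<open>Words over \<open>signed S\<close> act as permutations of \<open>{1..n}\<close>, so both
  sides of a relation fix every point outside; agreement on vertices is therefore equality of
  functions.\<close>

lemma GSol_iff:
  assumes "relation_system S E"
  shows "G \<in> GSol S E n \<longleftrightarrow>
    G \<in> sgraphs S n \<and> (\<forall>(w1, w2)\<in>E. word_act G w1 = word_act G w2)"
proof -
  have "word_act G w1 = word_act G w2"
    if "G \<in> sgraphs S n" "(w1, w2) \<in> E" "\<forall>x\<in>{1..n}. word_act G w1 x = word_act G w2 x" for w1 w2
  proof
    fix x
    have "w1 \<in> lists (signed S)" "w2 \<in> lists (signed S)"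
      using assms that(2) by (auto simp: relation_system_def)
    then show "word_act G w1 x = word_act G w2 x"
      using that(3) permutes_not_in[OF word_act_permutes[OF that(1)], of _ x]
      by (cases "x \<in> {1..n}") metis+
  qed
  then show ?thesis by (fastforce simp: GSol_def)
qed

subsection \<open>Classes of words in a finitely presented group\<close>

lemma normal_normal_closure:
  assumes "group G" "R \<subseteq> carrier G"
  shows "normal_closure G R \<lhd> G"
proof -
  let ?F = "{N. N \<lhd> G \<and> R \<subseteq> N}"
  interpret group G by fact
  have "carrier G \<lhd> G"
    by (simp add: normal_inv_iff subgroup_self)
  \<comment> \<open>The whole group is a member of the family. An empty family would have
    \<open>UNIV\<close> as its intersection.\<close>
  then have ne: "?F \<noteq> {}" using assms(2) by blast
  then have "subgroup (normal_closure G R) G"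
    unfolding normal_closure_def by (intro subgroups_Inter) (auto intro: normal_imp_subgroup)
  then show ?thesis
    using ne by (auto simp: normal_inv_iff normal_closure_def)
qed

lemma carrier_free_group: "w \<in> carrier (free_group S) \<longleftrightarrow> w \<in> lists (signed S) \<and> reduce w = w"
  and mult_free_group: "u \<otimes>\<^bsub>free_group S\<^esub> w = reduce (u @ w)"
  and one_free_group: "\<one>\<^bsub>free_group S\<^esub> = []"
  by (auto simp: free_group_def)

lemma reduce_in_free_group: "w \<in> lists (signed S) \<Longrightarrow> reduce w \<in> carrier (free_group S)"
  using reduce_in_lists by (auto simp: carrier_free_group)

lemma relators_in_free_group: "relation_system S E \<Longrightarrow> relators E \<subseteq> carrier (free_group S)"
  unfolding relators_def relation_system_def
  by (auto intro!: reduce_in_free_group dest: inv_word_in_lists)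

text \<open>The element of \<Gamma>(E) represented by an arbitrary word. Reducing inside the
  definition allows words to be concatenated and substituted without keeping them reduced.\<close>

definition word_class :: "'a set \<Rightarrow> 'a relsys \<Rightarrow> 'a word \<Rightarrow> 'a word set" where
  "word_class S E w = normal_closure (free_group S) (relators E) #>\<^bsub>free_group S\<^esub> reduce w"

lemma normal_relators:
  "relation_system S E \<Longrightarrow> normal_closure (free_group S) (relators E) \<lhd> free_group S"
  by (intro normal_normal_closure group_free_group relators_in_free_group)

lemma group_presented_group: "relation_system S E \<Longrightarrow> group (presented_group S E)"
  unfolding presented_group_def by (intro normal.factorgroup_is_group normal_relators)

text \<open>Reduction maps the words over \<open>signed S\<close> onto the free group. This is what
  later supplies words representing the images of generators under an isomorphism.\<close>

lemma carrier_presented_group: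
  "carrier (presented_group S E) = word_class S E ` lists (signed S)"
proof -
  have "carrier (free_group S) = reduce ` lists (signed S)"
    using reduce_in_free_group by (force simp: carrier_free_group)
  then show ?thesis
    by (auto simp: presented_group_def FactGroup_def RCOSETS_def word_class_def)
qed

lemma word_class_Nil:
  assumes "relation_system S E" shows "word_class S E [] = \<one>\<^bsub>presented_group S E\<^esub>"
proof -
  let ?N = "normal_closure (free_group S) (relators E)"
  have "?N #>\<^bsub>free_group S\<^esub> \<one>\<^bsub>free_group S\<^esub> = ?N"
    using normal_relators[OF assms] group.coset_mult_one[OF group_free_group]
    by (metis normal_imp_subgroup subgroup.subset)
  then show ?thesis
    by (simp add: word_class_def presented_group_def FactGroup_def one_free_group)
qed

lemma word_class_append:
  assumes "relation_system S E" "u \<in> lists (signed S)" "w \<in> lists (signed S)"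
  shows "word_class S E (u @ w) = word_class S E u \<otimes>\<^bsub>presented_group S E\<^esub> word_class S E w"
  using normal.rcos_sum[OF normal_relators[OF assms(1)]
      reduce_in_free_group[OF assms(2)] reduce_in_free_group[OF assms(3)]]
  by (simp add: word_class_def presented_group_def FactGroup_def mult_free_group)

lemma word_class_reduce: "word_class S E (reduce w) = word_class S E w"
  by (simp add: word_class_def)

lemma word_class_inv_word:
  assumes "relation_system S E" "w \<in> lists (signed S)"
  shows "word_class S E (inv_word w) = inv\<^bsub>presented_group S E\<^esub> word_class S E w"
proof -
  interpret group "presented_group S E" using assms(1) by (rule group_presented_group)
  have inv: "inv_word w \<in> lists (signed S)" using assms(2) by (rule inv_word_in_lists)
  have "word_class S E (inv_word w) \<otimes>\<^bsub>presented_group S E\<^esub> word_class S E w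
      = word_class S E (reduce (inv_word w @ w))"
    by (simp only: word_class_append[OF assms(1) inv assms(2)] word_class_reduce)
  also have "\<dots> = \<one>\<^bsub>presented_group S E\<^esub>"
    by (simp add: reduce_inv_word word_class_Nil[OF assms(1)])
  finally show ?thesis
    using assms(2) inv by (intro inv_equality[symmetric]) (auto simp: carrier_presented_group)
qed

text \<open>The relator of the pair lies in the normal closure, so its coset is the identity of the
  quotient; the inverse of the class of \<open>w2\<close> thus cancels the class of
  \<open>w1\<close>.\<close>

lemma word_class_relation:
  assumes "relation_system S E" "(w1, w2) \<in> E"
  shows "word_class S E w1 = word_class S E w2"
proof -
  let ?N = "normal_closure (free_group S) (relators E)"
  interpret group "presented_group S E" using assms(1) by (rule group_presented_group)
  have w: "w1 \<in> lists (signed S)" "w2 \<in> lists (signed S)"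
    using assms by (auto simp: relation_system_def)
  have i: "inv_word w2 \<in> lists (signed S)" using w(2) by (rule inv_word_in_lists)
  have "reduce (inv_word w2 @ w1) \<in> ?N"
    using assms(2) unfolding normal_closure_def relators_def by force
  then have "word_class S E (inv_word w2 @ w1) = ?N"
    unfolding word_class_def
    by (intro subgroup.rcos_const normal_imp_subgroup normal_relators[OF assms(1)] group_free_group)
  then have "inv\<^bsub>presented_group S E\<^esub> word_class S E w2 \<otimes>\<^bsub>presented_group S E\<^esub> word_class S E w1
      = \<one>\<^bsub>presented_group S E\<^esub>"
    using word_class_append[OF assms(1) i w(1)] word_class_inv_word[OF assms(1) w(2)]
    by (simp add: presented_group_def FactGroup_def)
  moreover have "word_class S E w1 \<in> carrier (presented_group S E)"
      "word_class S E w2 \<in> carrier (presented_group S E)"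
    using w by (auto simp: carrier_presented_group)
  ultimately show ?thesis by (metis inv_closed inv_equality inv_inv)
qed

text \<open>The universal property of \<Gamma>(E): acting on a solution is a homomorphism from the
  free group to a symmetric group that kills the relators. Its kernel is normal, hence contains the
  normal closure, and the action factors through \<Gamma>(E).\<close>

lemma word_act_cong_word_class:
  assumes E: "relation_system S E" and G: "G \<in> GSol S E n"
    and w: "w1 \<in> lists (signed S)" "w2 \<in> lists (signed S)"
    and eq: "word_class S E w1 = word_class S E w2"
  shows "word_act G w1 = word_act G w2"
proof -
  let ?N = "normal_closure (free_group S) (relators E)"
  have G': "G \<in> sgraphs S n" using G by (simp add: GSol_def)
  note act_reduce = word_act_reduce[OF G']
  have "word_act G \<in> hom (free_group S) (sym_group n)"
    unfolding hom_def using word_act_permutes[OF G'] act_reduce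
    by (auto simp: carrier_free_group mult_free_group sym_group_def word_act_append
       )
  then interpret group_hom "free_group S" "sym_group n" "word_act G"
    by (intro group_hom.intro group_hom_axioms.intro group_free_group sym_group_is_group)
  have "relators E \<subseteq> kernel (free_group S) (sym_group n) (word_act G)"
  proof
    fix r assume r: "r \<in> relators E"
    then obtain u1 u2 where u: "(u1, u2) \<in> E" "r = reduce (inv_word u2 @ u1)"
      by (auto simp: relators_def)
    have ul: "u1 \<in> lists (signed S)" "u2 \<in> lists (signed S)"
      using E u by (auto simp: relation_system_def)
    have "word_act G u1 = word_act G u2" using G u by (auto simp: GSol_iff[OF E])
    then have "word_act G r = inv' (word_act G u2) \<circ> word_act G u2"
      using ul inv_word_in_lists[OF ul(2)]
      by (simp add: u(2) act_reduce word_act_append word_act_inv_word[OF G'])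
    also have "\<dots> = id" using word_act_permutes[OF G' ul(2)] by (simp add: permutes_inv_o)
    finally show "r \<in> kernel (free_group S) (sym_group n) (word_act G)"
      using r relators_in_free_group[OF E] by (auto simp: kernel_def sym_group_def)
  qed
  then have N: "?N \<subseteq> kernel (free_group S) (sym_group n) (word_act G)"
    unfolding normal_closure_def using normal_kernel by blast
  \<comment> \<open>Equal cosets mean that the two reduced words differ by a left factor from the
    normal closure, which acts trivially.\<close>
  have "reduce w1 \<in> ?N #>\<^bsub>free_group S\<^esub> reduce w2"
    using eq G.rcos_self[OF reduce_in_free_group[OF w(1)] normal_imp_subgroup[OF normal_relators[OF E]]]
    by (simp add: word_class_def)
  then obtain k where k: "k \<in> ?N" "reduce w1 = k \<otimes>\<^bsub>free_group S\<^esub> reduce w2"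
    by (auto simp: r_coset_def)
  have "word_act G (reduce w1) = word_act G k \<circ> word_act G (reduce w2)"
    using k N reduce_in_free_group[OF w(2)] by (auto simp: kernel_def sym_group_def)
  moreover have "word_act G k = id" using k N by (auto simp: kernel_def sym_group_def)
  ultimately show ?thesis using act_reduce w by simp
qed

subsection \<open>Substitution of words for generators\<close>

fun subst_letter :: "('a \<Rightarrow> 'b word) \<Rightarrow> 'a letter \<Rightarrow> 'b word" where
  "subst_letter v (Pos s) = v s"
| "subst_letter v (Neg s) = inv_word (v s)"

definition subst_word :: "('a \<Rightarrow> 'b word) \<Rightarrow> 'a word \<Rightarrow> 'b word" where
  "subst_word v w = concat (map (subst_letter v) w)"

text \<open>Each label acts by the word substituted for it. The function is restricted to
  \<open>S\<close> because elements of \<open>sgraphs\<close> are extensional.\<close>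

definition pullback :: "'a set \<Rightarrow> ('a \<Rightarrow> 'b word) \<Rightarrow> 'b sgraph \<Rightarrow> 'a sgraph" where
  "pullback S v G = (\<lambda>s\<in>S. word_act G (v s))"

lemma subst_letter_in_lists:
  assumes "v \<in> S \<rightarrow> lists (signed T)" "a \<in> signed S"
  shows "subst_letter v a \<in> lists (signed T)"
  using assms(2) funcset_mem[OF assms(1)] inv_word_in_lists by (fastforce simp: signed_def)

lemma subst_word_simps [simp]:
  "subst_word v [] = []" "subst_word v (a # w) = subst_letter v a @ subst_word v w"
  by (simp_all add: subst_word_def)

lemma subst_word_in_lists:
  assumes "v \<in> S \<rightarrow> lists (signed T)" "w \<in> lists (signed S)"
  shows "subst_word v w \<in> lists (signed T)"
  using assms(2)
proof induction
  case (Cons a w)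
  then show ?case using subst_letter_in_lists[OF assms(1)]
    by (simp)
qed simp

lemma pullback_in_sgraphs:
  assumes "v \<in> S \<rightarrow> lists (signed T)" "G \<in> sgraphs T n"
  shows "pullback S v G \<in> sgraphs S n"
  using funcset_mem[OF assms(1)] word_act_permutes[OF assms(2)]
  by (auto simp: sgraphs_def[of S] pullback_def intro!: PiE_I)

lemma letter_act_pullback:
  assumes "v \<in> S \<rightarrow> lists (signed T)" "G \<in> sgraphs T n" "a \<in> signed S"
  shows "letter_act (pullback S v G) a = word_act G (subst_letter v a)"
  using assms
  using word_act_inv_word[OF assms(2) funcset_mem[OF assms(1)]]
  by (auto simp: signed_def[of S] letter_act_Pos letter_act_Neg pullback_def)

lemma word_act_pullback:
  assumes "v \<in> S \<rightarrow> lists (signed T)" "G \<in> sgraphs T n" "w \<in> lists (signed S)"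
  shows "word_act (pullback S v G) w = word_act G (subst_word v w)"
  using assms(3)
  by induction (simp_all add: letter_act_pullback[OF assms(1,2)] word_act_append)

section \<open>Group homomorphisms realised by substitution\<close>

text \<open>A homomorphism is determined by its values on generators; negative letters are covered
  because \<open>h\<close> and \<open>inv_word\<close> both respect inverses.\<close>

lemma hom_word_class:
  assumes E1: "relation_system S E1" and E2: "relation_system T E2"
    and h: "h \<in> hom (presented_group S E1) (presented_group T E2)"
    and v: "v \<in> S \<rightarrow> lists (signed T)"
    and hv: "\<And>s. s \<in> S \<Longrightarrow> h (word_class S E1 [Pos s]) = word_class T E2 (v s)"
    and w: "w \<in> lists (signed S)"
  shows "h (word_class S E1 w) = word_class T E2 (subst_word v w)"
proof -
  interpret group_hom "presented_group S E1" "presented_group T E2" h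
    using h by (intro group_hom.intro group_hom_axioms.intro group_presented_group E1 E2)
  have letter: "h (word_class S E1 [a]) = word_class T E2 (subst_letter v a)"
    if a: "a \<in> signed S" for a
  proof (cases a)
    case (Pos s)
    then show ?thesis using a hv by (auto simp: signed_def)
  next
    case (Neg s)
    then have s: "s \<in> S" using a by (auto simp: signed_def)
    then have p: "[Pos s] \<in> lists (signed S)" by (auto simp: signed_def)
    have "[a] = inv_word [Pos s]" using Neg by (simp add: inv_word_def)
    then have "h (word_class S E1 [a]) = inv\<^bsub>presented_group T E2\<^esub> (h (word_class S E1 [Pos s]))"
      using p by (simp add: word_class_inv_word[OF E1 p] carrier_presented_group)
    also have "\<dots> = word_class T E2 (inv_word (v s))"
      using s v by (simp add: hv word_class_inv_word[OF E2] funcset_mem[OF v])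
    finally show ?thesis using Neg by simp
  qed
  show ?thesis using w
  proof induction
    case Nil
    then show ?case by (simp add: word_class_Nil E1 E2)
  next
    case (Cons a w)
    have a: "[a] \<in> lists (signed S)" using Cons by simp
    have "h (word_class S E1 (a # w))
        = h (word_class S E1 [a]) \<otimes>\<^bsub>presented_group T E2\<^esub> h (word_class S E1 w)"
      using word_class_append[OF E1 a, of w] Cons a
      by (simp add: carrier_presented_group)
    also have "\<dots> = word_class T E2 (subst_letter v a @ subst_word v w)"
      using Cons letter word_class_append[OF E2 subst_letter_in_lists[OF v] subst_word_in_lists[OF v]]
      by simp
    finally show ?case by simp
  qed
qed

text \<open>The two sides of a relation in \<open>E1\<close> have the same class, so by
  \<open>h\<close> their substituted words have the same class in \<Gamma>(E2). On a solution of
  \<open>E2\<close> these words then act equally.\<close>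

lemma pullback_in_GSol:
  assumes E1: "relation_system S E1" and E2: "relation_system T E2"
    and h: "h \<in> hom (presented_group S E1) (presented_group T E2)"
    and v: "v \<in> S \<rightarrow> lists (signed T)"
    and hv: "\<And>s. s \<in> S \<Longrightarrow> h (word_class S E1 [Pos s]) = word_class T E2 (v s)"
    and G: "G \<in> GSol T E2 n"
  shows "pullback S v G \<in> GSol S E1 n"
proof -
  have G': "G \<in> sgraphs T n" using G by (simp add: GSol_def)
  have "word_act (pullback S v G) w1 = word_act (pullback S v G) w2" if w12: "(w1, w2) \<in> E1" for w1 w2
  proof -
    have w: "w1 \<in> lists (signed S)" "w2 \<in> lists (signed S)"
      using E1 w12 by (auto simp: relation_system_def)
    have "word_class T E2 (subst_word v w1) = word_class T E2 (subst_word v w2)"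
      using word_class_relation[OF E1 w12] hom_word_class[OF E1 E2 h v hv] w by metis
    then show ?thesis
      using word_act_cong_word_class[OF E2 G] subst_word_in_lists[OF v] w
      by (simp add: word_act_pullback[OF v G'])
  qed
  then show ?thesis using pullback_in_sgraphs[OF v G'] by (auto simp: GSol_iff[OF E1])
qed

subsection \<open>Distances\<close>

lemma card_letter_act_diff:
  assumes "G \<in> sgraphs S n" "G' \<in> sgraphs S n" "a \<in> signed S" "finite S" "n \<ge> 1"
  shows "card {x\<in>{1..n}. letter_act G a x \<noteq> letter_act G' a x} \<le> n * hamming_dist S n G G'"
proof -
  let ?D = "\<lambda>s. {x\<in>{1..n}. G s x \<noteq> G' s x}"
  have sum: "real n * hamming_dist S n G G' = (\<Sum>s\<in>S. real (card (?D s)))"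
    using assms(5) by (simp add: hamming_dist_def sum_distrib_left)
  obtain s where s: "s \<in> S" "a = Pos s \<or> a = Neg s" using assms(3) by (auto simp: signed_def)
  have p: "G s permutes {1..n}" "G' s permutes {1..n}" using assms s by (auto intro: sgraphs_permutes)
  have "card {x\<in>{1..n}. letter_act G a x \<noteq> letter_act G' a x} \<le> card (?D s)"
    using s(2)
  proof
    assume "a = Neg s"
    \<comment> \<open>Where the inverses differ at \<open>x\<close>, the permutations themselves
      differ at the \<open>G\<close>-preimage of \<open>x\<close>. This injects one disagreement set
      into the other.\<close>
    moreover have "inv' (G s) ` {x\<in>{1..n}. inv' (G s) x \<noteq> inv' (G' s) x} \<subseteq> ?D s"
    proof safe
      fix x assume x: "x \<in> {1..n}" "inv' (G s) x \<noteq> inv' (G' s) x"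
      show "inv' (G s) x \<in> {1..n}" using x permutes_in_image[OF permutes_inv[OF p(1)]] by blast
      assume "G s (inv' (G s) x) = G' s (inv' (G s) x)"
      then show False using x(2) permutes_inverses[OF p(1)] permutes_inverses[OF p(2)] by metis
    qed
    ultimately show ?thesis
      using inj_on_subset[OF permutes_inj[OF permutes_inv[OF p(1)]] subset_UNIV]
      by (intro card_inj_on_le[of "inv' (G s)"]) (simp_all add: letter_act_Neg)
  qed simp
  also have "real (card (?D s)) \<le> (\<Sum>s\<in>S. real (card (?D s)))"
    using s(1) assms(4) by (intro member_le_sum) auto
  finally show ?thesis using sum by simp
qed

text \<open>A union bound over letters: \<open>a # w\<close> acts differently at \<open>x\<close>
  only if \<open>w\<close> does, or if \<open>a\<close> does at the vertex reached by
  \<open>w\<close> in \<open>G\<close>. The second set is a preimage under a permutation, so its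
  size is that of the disagreement set of \<open>a\<close>.\<close>

lemma card_word_act_diff:
  assumes "G \<in> sgraphs S n" "G' \<in> sgraphs S n" "w \<in> lists (signed S)" "finite S" "n \<ge> 1"
  shows "card {x\<in>{1..n}. word_act G w x \<noteq> word_act G' w x}
    \<le> length w * (n * hamming_dist S n G G')"
  using assms(3)
proof induction
  case (Cons a w)
  let ?D = "\<lambda>w. {x\<in>{1..n}. word_act G w x \<noteq> word_act G' w x}"
  let ?B = "{x\<in>{1..n}. letter_act G a x \<noteq> letter_act G' a x}"
  have p: "word_act G w permutes {1..n}" using Cons assms(1) by (intro word_act_permutes) auto
  have "?D (a # w) \<subseteq> ?D w \<union> word_act G w -` ?B"
    using permutes_in_image[OF p] by auto
  moreover have "finite (word_act G w -` ?B)"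
    using permutes_inj[OF p] by (intro finite_vimageI) auto
  ultimately have "card (?D (a # w)) \<le> card (?D w \<union> word_act G w -` ?B)"
    by (intro card_mono) auto
  also have "\<dots> \<le> card (?D w) + card (word_act G w -` ?B)" by (rule card_Un_le)
  also have "card (word_act G w -` ?B) = card ?B"
    using permutes_inj[OF p] permutes_surj[OF p] by (intro card_vimage_inj) auto
  finally show ?case
    using Cons card_letter_act_diff[OF assms(1,2) _ assms(4,5), of a] by (simp add: algebra_simps)
qed simp

text \<open>Pulling back is Lipschitz: the bound for a single word is summed over the labels in
  \<open>T\<close>.\<close>

lemma hamming_dist_pullback:
  assumes "finite S" "finite T" "n \<ge> 1" and u: "u \<in> T \<rightarrow> lists (signed S)"
    and H: "H \<in> sgraphs S n" "H' \<in> sgraphs S n"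
  shows "hamming_dist T n (pullback T u H) (pullback T u H')
    \<le> (\<Sum>t\<in>T. length (u t)) * hamming_dist S n H H'"
proof -
  have "hamming_dist T n (pullback T u H) (pullback T u H')
      \<le> (\<Sum>t\<in>T. 1 / real n * (length (u t) * (n * hamming_dist S n H H')))"
    unfolding hamming_dist_def[of T]
  proof (intro sum_mono mult_left_mono)
    fix t assume t: "t \<in> T"
    then show "card {x \<in> {1..n}. pullback T u H t x \<noteq> pullback T u H' t x}
        \<le> length (u t) * (n * hamming_dist S n H H')"
      using card_word_act_diff[OF H _ assms(1,3), of "u t"] u
      by (simp add: pullback_def Pi_iff)
  qed simp
  also have "\<dots> = (\<Sum>t\<in>T. length (u t)) * hamming_dist S n H H'"
    using assms(3) by (simp add: sum_distrib_right)
  finally show ?thesis .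
qed

lemma hamming_dist_triangle:
  "hamming_dist S n G G'' \<le> hamming_dist S n G G' + hamming_dist S n G' G''"
proof -
  have "card {x\<in>{1..n}. G s x \<noteq> G'' s x}
      \<le> card {x\<in>{1..n}. G s x \<noteq> G' s x} + card {x\<in>{1..n}. G' s x \<noteq> G'' s x}" for s
    by (intro order.trans[OF card_mono card_Un_le]) auto
  then show ?thesis
    unfolding hamming_dist_def
    by (simp add: sum_mono divide_right_mono flip: sum.distrib add_divide_distrib of_nat_add)
qed

text \<open>Each label disagrees only at vertices where some label does. So a large distance forces
  a large density of bad vertices, which random sampling can find.\<close>

lemma hamming_dist_le_card:
  assumes "finite S"
  shows "hamming_dist S n G G' \<le> card S * (card {x\<in>{1..n}. \<exists>s\<in>S. G s x \<noteq> G' s x} / n)"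
proof -
  have "hamming_dist S n G G'
      \<le> (\<Sum>s\<in>S. 1 / real n * card {x\<in>{1..n}. \<exists>s\<in>S. G s x \<noteq> G' s x})"
    unfolding hamming_dist_def
    by (intro sum_mono mult_left_mono of_nat_mono card_mono) auto
  then show ?thesis by simp
qed

subsection \<open>Decision trees\<close>

text \<open>Written in continuation-passing style: \<open>k\<close> receives the endpoint of the
  walk. The tail is queried first because the rightmost letter acts first.\<close>

fun query_word :: "'a word \<Rightarrow> nat \<Rightarrow> (nat \<Rightarrow> 'a dtree) \<Rightarrow> 'a dtree" where
  "query_word [] x k = k x"
| "query_word (a # w) x k = query_word w x (\<lambda>y. Query a y k)"

lemma accepts_query_word [simp]:
  "accepts G (query_word w x k) = accepts G (k (word_act G w x))"
  by (induction w arbitrary: k) auto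

lemma length_queries_query_word [simp]:
  "length (queries G (query_word w x k)) = length w + length (queries G (k (word_act G w x)))"
  by (induction w arbitrary: k) auto

lemma set_queries_query_word:
  assumes "G \<in> sgraphs S n" "w \<in> lists (signed S)" "x \<in> {1..n}"
    and "set (queries G (k (word_act G w x))) \<subseteq> signed S \<times> {1..n}"
  shows "set (queries G (query_word w x k)) \<subseteq> signed S \<times> {1..n}"
  using assms(2,4)
proof (induction arbitrary: k)
  case (Cons a w)
  have "word_act G w x \<in> {1..n}"
    using permutes_in_image[OF word_act_permutes[OF assms(1)]] Cons(2) assms(3) by blast
  with Cons show ?case by simp
qed simp

primrec simulate :: "('a \<Rightarrow> 'b word) \<Rightarrow> 'a dtree \<Rightarrow> 'b dtree" where
  "simulate v (Decide b) = Decide b"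
| "simulate v (Query a x k) = query_word (subst_letter v a) x (\<lambda>y. simulate v (k y))"

text \<open>Each query to the pullback becomes a walk of length at most \<open>M\<close> in
  \<open>G\<close>. The hypothesis on queries concerns only the branch taken, and guarantees that
  every simulated letter is one on which the pullback acts by substitution.\<close>

lemma simulate_correct:
  assumes v: "v \<in> S \<rightarrow> lists (signed T)" and G: "G \<in> sgraphs T n"
    and M: "\<And>s. s \<in> S \<Longrightarrow> length (v s) \<le> M"
    and "set (queries (pullback S v G) t) \<subseteq> signed S \<times> {1..n}"
  shows "accepts G (simulate v t) = accepts (pullback S v G) t"
    and "length (queries G (simulate v t)) \<le> M * length (queries (pullback S v G) t)"
    and "set (queries G (simulate v t)) \<subseteq> signed T \<times> {1..n}"
proof -
  have "accepts G (simulate v t) = accepts (pullback S v G) t \<and>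
    length (queries G (simulate v t)) \<le> M * length (queries (pullback S v G) t) \<and>
    set (queries G (simulate v t)) \<subseteq> signed T \<times> {1..n}"
    using assms(4)
  proof (induction t)
    case (Query a x k)
    let ?y = "word_act G (subst_letter v a) x"
    have a: "a \<in> signed S" and x: "x \<in> {1..n}" using Query.prems by auto
    have y: "letter_act (pullback S v G) a x = ?y" by (simp add: letter_act_pullback[OF v G a])
    have "set (queries (pullback S v G) (k ?y)) \<subseteq> signed S \<times> {1..n}" using Query.prems y by simp
    note IH = Query.IH[OF rangeI this]
    have "length (subst_letter v a) \<le> M"
      using a M by (auto simp: signed_def inv_word_def)
    with IH y show ?case
      using set_queries_query_word[OF G subst_letter_in_lists[OF v a] x] by auto
  qed simp
  then show "accepts G (simulate v t) = accepts (pullback S v G) t"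
    and "length (queries G (simulate v t)) \<le> M * length (queries (pullback S v G) t)"
    and "set (queries G (simulate v t)) \<subseteq> signed T \<times> {1..n}" by auto
qed

section \<open>Checking word identities at chosen vertices\<close>

text \<open>A failed comparison rejects at once; otherwise \<open>t\<close> runs. Taking the
  remaining tree as an argument lets checks at several vertices be chained by \<open>foldr\<close>
  in front of a simulated tree.\<close>

fun check_at :: "('a word \<times> 'a word) list \<Rightarrow> nat \<Rightarrow> 'a dtree \<Rightarrow> 'a dtree" where
  "check_at [] x t = t"
| "check_at ((w1, w2) # R) x t =
     query_word w1 x (\<lambda>y. query_word w2 x (\<lambda>z. if y = z then check_at R x t else Decide False))"

lemma accepts_check_at [simp]:
  "accepts G (check_at R x t) \<longleftrightarrow>
     (\<forall>(w1, w2)\<in>set R. word_act G w1 x = word_act G w2 x) \<and> accepts G t"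
  by (induction R x t rule: check_at.induct) auto

lemma length_queries_check_at:
  "length (queries G (check_at R x t))
    \<le> (\<Sum>(w1, w2)\<leftarrow>R. length w1 + length w2) + length (queries G t)"
  by (induction R x t rule: check_at.induct) auto

lemma set_queries_check_at:
  assumes "G \<in> sgraphs S n" "set R \<subseteq> lists (signed S) \<times> lists (signed S)" "x \<in> {1..n}"
    and "set (queries G t) \<subseteq> signed S \<times> {1..n}"
  shows "set (queries G (check_at R x t)) \<subseteq> signed S \<times> {1..n}"
  using assms(2)
proof (induction R)
  case (Cons r R)
  obtain w1 w2 where r: "r = (w1, w2)" by fastforce
  have w: "w1 \<in> lists (signed S)" "w2 \<in> lists (signed S)" using Cons.prems r by auto
  have "word_act G w1 x \<in> {1..n}"
    using permutes_in_image[OF word_act_permutes[OF assms(1) w(1)]] assms(3) by blast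
  then show ?case
    unfolding r check_at.simps using Cons assms(1,3) w
    by (intro set_queries_query_word) auto
qed (use assms(4) in simp)

lemma accepts_foldr_check_at:
  "accepts G (foldr (check_at R) xs t) \<longleftrightarrow>
     (\<forall>x\<in>set xs. \<forall>(w1, w2)\<in>set R. word_act G w1 x = word_act G w2 x) \<and> accepts G t"
  by (induction xs) auto

lemma length_queries_foldr_check_at:
  "length (queries G (foldr (check_at R) xs t))
    \<le> length xs * (\<Sum>(w1, w2)\<leftarrow>R. length w1 + length w2) + length (queries G t)"
proof (induction xs)
  case (Cons x xs)
  then show ?case
    using length_queries_check_at[of G R x "foldr (check_at R) xs t"] by simp
qed simp

lemma set_queries_foldr_check_at:
  assumes "G \<in> sgraphs S n" "set R \<subseteq> lists (signed S) \<times> lists (signed S)" "set xs \<subseteq> {1..n}"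
    and "set (queries G t) \<subseteq> signed S \<times> {1..n}"
  shows "set (queries G (foldr (check_at R) xs t)) \<subseteq> signed S \<times> {1..n}"
  using assms(3)
  by (induction xs) (simp_all add: assms(4) set_queries_check_at[OF assms(1,2)])

subsection \<open>Transfer of testers\<close>

text \<open>The first sample is independent of the remaining list, so the event is a product set and
  its probability factors.\<close>

lemma prob_replicate_pmf_subset:
  fixes p :: "'a :: countable pmf"
  shows "measure_pmf.prob (replicate_pmf m p) {xs. set xs \<subseteq> A} = measure_pmf.prob p A ^ m"
proof (induction m)
  case (Suc m)
  have "replicate_pmf (Suc m) p = map_pmf (\<lambda>(x, xs). x # xs) (pair_pmf p (replicate_pmf m p))"
    by (simp add: pair_pmf_def map_bind_pmf)
  moreover have "(\<lambda>(x, xs). x # xs) -` {xs. set xs \<subseteq> A} = A \<times> {xs. set xs \<subseteq> A}"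
    by auto
  ultimately show ?case
    by (simp only: measure_map_pmf measure_pmf_prob_product[OF countableI_type countableI_type]
        Suc power_Suc)
qed simp

text \<open>The soundness dichotomy: if the pullback is not far from solutions, then the round trip
  through \<open>v\<close> and \<open>u\<close> fails at a positive fraction of vertices. The
  \<open>+ 1\<close> in each denominator keeps both thresholds positive even if \<open>T\<close> is
  empty or all words \<open>u t\<close> are.\<close>

lemma far_pullback_cases:
  assumes "finite S" "finite T" "n \<ge> 1"
    and v: "v \<in> S \<rightarrow> lists (signed T)" and u: "u \<in> T \<rightarrow> lists (signed S)"
    and sol: "\<And>H. H \<in> GSol S E1 n \<Longrightarrow> pullback T u H \<in> GSol T E2 n"
    and G: "G \<in> GSol_far T E2 \<epsilon> n"
    and "pullback S v G \<notin> GSol_far S E1 (\<epsilon> / (2 * (real (\<Sum>t\<in>T. length (u t)) + 1))) n"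
    and "\<epsilon> > 0"
  shows "\<epsilon> / (2 * (real (card T) + 1))
    \<le> card {x\<in>{1..n}. \<exists>t\<in>T. G t x \<noteq> word_act G (subst_word v (u t)) x} / n"
proof -
  define H where "H = pullback S v G"
  define L where "L = real (\<Sum>t\<in>T. length (u t))"
  have L: "L \<ge> 0" unfolding L_def by (rule of_nat_0_le_iff)
  have G': "G \<in> sgraphs T n" using G by (simp add: GSol_far_def)
  have H: "H \<in> sgraphs S n" unfolding H_def by (rule pullback_in_sgraphs[OF v G'])
  then obtain H' where H': "H' \<in> GSol S E1 n" "hamming_dist S n H H' < \<epsilon> / (2 * (L + 1))"
    using assms(8) unfolding H_def[symmetric] L_def[symmetric] GSol_far_def
    by (auto simp: not_le)
  have HH': "H' \<in> sgraphs S n" using H'(1) by (simp add: GSol_def)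
  let ?B = "{x\<in>{1..n}. \<exists>t\<in>T. G t x \<noteq> pullback T u H t x}"
  have "\<epsilon> \<le> hamming_dist T n G (pullback T u H')"
    using G sol[OF H'(1)] by (simp add: GSol_far_def)
  also have "\<dots> \<le> hamming_dist T n G (pullback T u H) + L * hamming_dist S n H H'"
    using hamming_dist_triangle hamming_dist_pullback[OF assms(1-3) u H HH']
    unfolding L_def by (meson add_left_mono order.trans)
  \<comment> \<open>The threshold for \<open>H'\<close> is chosen so that the Lipschitz factor
    \<open>L\<close> uses up at most half of \<epsilon>; the other half must come from the distance
    between \<open>G\<close> and its round trip.\<close>
  also have "L * hamming_dist S n H H' \<le> L * (\<epsilon> / (2 * (L + 1)))"
    using H' L by (intro mult_left_mono) auto
  also have "\<dots> \<le> \<epsilon> / 2"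
    using L \<open>\<epsilon> > 0\<close> by (simp add: field_simps)
  finally have "\<epsilon> / 2 \<le> card T * (card ?B / n)"
    using hamming_dist_le_card[OF assms(2), of n G "pullback T u H"] by linarith
  also have "\<dots> \<le> (real (card T) + 1) * (card ?B / n)"
    by (intro mult_right_mono) auto
  finally have "\<epsilon> / (2 * (real (card T) + 1)) \<le> card ?B / n"
    by (simp add: field_simps add_pos_nonneg)
  also have "?B = {x\<in>{1..n}. \<exists>t\<in>T. G t x \<noteq> word_act G (subst_word v (u t)) x}"
    using u word_act_pullback[OF v G'] by (auto simp: pullback_def[of T] H_def Pi_iff)
  finally show ?thesis .
qed

text \<open>Here the isomorphism enters only through its effect on solutions: both substitutions
  preserve them, and the round trip on \<open>T\<close> acts trivially on them. The new tester draws
  a tree of the old one and, independently, \<open>m\<close> uniform vertices to check.\<close>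

lemma testable_transfer:
  assumes fin: "finite S" "finite T"
    and v: "v \<in> S \<rightarrow> lists (signed T)" and u: "u \<in> T \<rightarrow> lists (signed S)"
    and solS: "\<And>n G. G \<in> GSol T E2 n \<Longrightarrow> pullback S v G \<in> GSol S E1 n"
    and solT: "\<And>n H. H \<in> GSol S E1 n \<Longrightarrow> pullback T u H \<in> GSol T E2 n"
    and rt: "\<And>n G t. G \<in> GSol T E2 n \<Longrightarrow> t \<in> T \<Longrightarrow> word_act G (subst_word v (u t)) = G t"
    and test: "testable S E1"
  shows "testable T E2"
  unfolding testable_def
proof (intro allI impI)
  fix \<epsilon> :: real assume \<epsilon>: "\<epsilon> > 0"
  define \<delta> where "\<delta> = \<epsilon> / (2 * (real (\<Sum>t\<in>T. length (u t)) + 1))"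
  define c where "c = \<epsilon> / (2 * (real (card T) + 1))"
  have "\<delta> > 0" unfolding \<delta>_def using \<epsilon> by (intro divide_pos_pos mult_pos_pos add_nonneg_pos)
    (auto simp del: of_nat_sum)
  then obtain q A where A: "is_tester S E1 \<delta> q A" using test unfolding testable_def by blast
  have c: "c > 0" unfolding c_def using \<epsilon> by (intro divide_pos_pos mult_pos_pos add_nonneg_pos) auto
  \<comment> \<open>With this many samples, a set of density at least \<open>c\<close> is missed
    with probability below 1/100. The maximum with 0 covers \<open>c > 1\<close>.\<close>
  obtain m where m: "max 0 (1 - c) ^ m < 1 / 100"
    using real_arch_pow_inv[of "1 / 100" "max 0 (1 - c)"] c by auto
  obtain ts where ts: "set ts = T" using fin(2) finite_list by blast
  \<comment> \<open>Each generator of \<open>T\<close> is compared with its round trip.\<close>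
  define R where "R = map (\<lambda>t. ([Pos t], subst_word v (u t))) ts"
  define K where "K = (\<Sum>(w1, w2)\<leftarrow>R. length w1 + length w2)"
  define M where "M = (\<Sum>s\<in>S. length (v s))"
  define P where "P n = pair_pmf (A n) (replicate_pmf m (pmf_of_set {1..n}))" for n :: nat
  define A' where "A' n = map_pmf (\<lambda>(t, xs). foldr (check_at R) xs (simulate v t)) (P n)" for n
  have R: "set R \<subseteq> lists (signed T) \<times> lists (signed T)"
    using subst_word_in_lists[OF v] u ts by (auto simp: R_def signed_def Pi_iff)
  have M: "length (v s) \<le> M" if "s \<in> S" for s
    using member_le_sum[of s S "\<lambda>s. length (v s)"] that fin(1) by (simp add: M_def)
  have queries: "set (queries (pullback S v G) t) \<subseteq> signed S \<times> {1..n}"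
      "length (queries (pullback S v G) t) \<le> q"
    if "n \<ge> 1" "G \<in> sgraphs T n" "t \<in> set_pmf (A n)" for n G t
    using A that pullback_in_sgraphs[OF v that(2)] unfolding is_tester_def by blast+
  have prob: "measure_pmf.prob (A' n) {t. accepts G t = b} =
      measure_pmf.prob (P n) {(t, xs).
        ((\<forall>x\<in>set xs. \<forall>t\<in>T. G t x = word_act G (subst_word v (u t)) x)
          \<and> accepts (pullback S v G) t) = b}"
    (is "_ = measure_pmf.prob _ ?X") if "n \<ge> 1" "G \<in> sgraphs T n" for n G b
  proof -
    let ?f = "\<lambda>(t, xs). foldr (check_at R) xs (simulate v t)"
    have "measure_pmf.prob (A' n) {t. accepts G t = b}
        = measure_pmf.prob (P n) (?f -` {t. accepts G t = b})"
      by (simp add: A'_def)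
    also have "\<dots> = measure_pmf.prob (P n) ?X"
    \<comment> \<open>The two events need only agree on the support of \<open>P n\<close>: the
      simulation is known to be faithful for trees that the given tester can draw, whose queries are
      legal.\<close>
    proof (rule measure_prob_cong_0)
      fix p assume p: "p \<in> ?f -` {t. accepts G t = b} - ?X"
      then show "pmf (P n) p = 0"
        using simulate_correct(1)[OF v that(2) M queries(1)[OF that]] ts
        by (cases p) (auto simp: P_def accepts_foldr_check_at R_def letter_act_Pos pmf_pair set_pmf_iff)
    next
      fix p assume p: "p \<in> ?X - ?f -` {t. accepts G t = b}"
      then show "pmf (P n) p = 0"
        using simulate_correct(1)[OF v that(2) M queries(1)[OF that]] ts
        by (cases p) (auto simp: P_def accepts_foldr_check_at R_def letter_act_Pos pmf_pair set_pmf_iff)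
    qed
    finally show ?thesis .
  qed
  have fst: "measure_pmf.prob (P n) {(t, xs). Q t} = measure_pmf.prob (A n) {t. Q t}" for n Q
  proof -
    have "measure_pmf.prob (A n) {t. Q t} = measure_pmf.prob (map_pmf fst (P n)) {t. Q t}"
      by (simp add: P_def map_fst_pair_pmf)
    also have "\<dots> = measure_pmf.prob (P n) {(t, xs). Q t}"
      by (simp add: case_prod_unfold vimage_def)
    finally show ?thesis by simp
  qed
  have "is_tester T E2 \<epsilon> (m * K + M * q) A'"
    unfolding is_tester_def
  proof (intro allI impI conjI ballI)
    fix n G assume n: "n \<ge> 1" and G: "G \<in> GSol T E2 n"
    have G': "G \<in> sgraphs T n" using G by (simp add: GSol_def)
    have "99/100 \<le> measure_pmf.prob (A n) {t. accepts (pullback S v G) t}"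
      using A n solS[OF G] by (auto simp: is_tester_def)
    also have "\<dots> = measure_pmf.prob (A' n) {t. accepts G t}"
      \<comment> \<open>On a solution every check passes, so the acceptance probability is exactly
        that of the old tester on the pullback.\<close>
      using prob[OF n G', of True] rt[OF G] fst[of n "accepts (pullback S v G)"] by simp
    finally show "99/100 \<le> measure_pmf.prob (A' n) {t. accepts G t}" .
  next
    fix n G assume n: "n \<ge> 1" and G: "G \<in> GSol_far T E2 \<epsilon> n"
    have G': "G \<in> sgraphs T n" using G by (simp add: GSol_far_def)
    let ?X = "{(t, xs). ((\<forall>x\<in>set xs. \<forall>t\<in>T. G t x = word_act G (subst_word v (u t)) x)
          \<and> accepts (pullback S v G) t) = False}"
    have "99/100 \<le> measure_pmf.prob (P n) ?X"
    proof (cases "pullback S v G \<in> GSol_far S E1 \<delta> n")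
      case True
      then have "99/100 \<le> measure_pmf.prob (A n) {t. \<not> accepts (pullback S v G) t}"
        using A n by (auto simp: is_tester_def)
      \<comment> \<open>Additional checks can only add rejections.\<close>
      also have "\<dots> \<le> measure_pmf.prob (P n) ?X"
        unfolding fst[symmetric] by (intro measure_pmf.finite_measure_mono) auto
      finally show ?thesis .
    next
      case False
      let ?bad = "{x\<in>{1..n}. \<exists>t\<in>T. G t x \<noteq> word_act G (subst_word v (u t)) x}"
      let ?good = "{x. \<forall>t\<in>T. G t x = word_act G (subst_word v (u t)) x}"
      let ?U = "pmf_of_set {1..n}"
      have cbad: "c \<le> card ?bad / n"
        using far_pullback_cases[OF fin n v u solT G _ \<epsilon>] False unfolding \<delta>_def c_def by blast
      have "{1..n} \<inter> - ?good = ?bad" by auto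
      then have "measure_pmf.prob ?U (- ?good) = card ?bad / n"
        using n by (simp add: measure_pmf_of_set)
      then have "measure_pmf.prob ?U ?good \<le> max 0 (1 - c)"
        using cbad measure_pmf.prob_compl[of ?good ?U] by (simp add: Compl_eq_Diff_UNIV)
      then have "measure_pmf.prob (replicate_pmf m ?U) {xs. set xs \<subseteq> ?good} \<le> max 0 (1 - c) ^ m"
        unfolding prob_replicate_pmf_subset by (intro power_mono) auto
      then have "measure_pmf.prob (replicate_pmf m ?U) {xs. set xs \<subseteq> ?good} \<le> 1/100"
        using m by linarith
      \<comment> \<open>Rejection now comes from the samples alone, whatever the simulated tree
        decides.\<close>
      then have "99/100 \<le> measure_pmf.prob (replicate_pmf m ?U) (- {xs. set xs \<subseteq> ?good})"
        using measure_pmf.prob_compl[of "{xs. set xs \<subseteq> ?good}" "replicate_pmf m ?U"]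
        by (simp add: Compl_eq_Diff_UNIV)
      also have "\<dots> = measure_pmf.prob (map_pmf snd (P n)) (- {xs. set xs \<subseteq> ?good})"
        by (simp add: P_def map_snd_pair_pmf)
      also have "\<dots> = measure_pmf.prob (P n) (snd -` (- {xs. set xs \<subseteq> ?good}))"
        by (simp only: measure_map_pmf)
      also have "\<dots> \<le> measure_pmf.prob (P n) ?X"
        by (intro measure_pmf.finite_measure_mono) auto
      finally show ?thesis .
    qed
    then show "99/100 \<le> measure_pmf.prob (A' n) {t. \<not> accepts G t}"
      using prob[OF n G', of False] by simp
  next
    fix n G t' assume n: "n \<ge> 1" and G: "G \<in> sgraphs T n" and "t' \<in> set_pmf (A' n)"
    then obtain t xs where t: "t \<in> set_pmf (A n)" and t': "t' = foldr (check_at R) xs (simulate v t)"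
      and xs: "length xs = m" "set xs \<subseteq> {1..n}"
      by (auto simp: A'_def P_def set_replicate_pmf in_lists_conv_set subset_iff)
    note q = queries[OF n G t]
    note sim = simulate_correct[OF v G M q(1)]
    have "length (queries G t') \<le> m * K + length (queries G (simulate v t))"
      using length_queries_foldr_check_at[of G R xs "simulate v t"] by (simp add: t' xs K_def)
    also have "length (queries G (simulate v t)) \<le> M * q"
      using sim(2) q(2) by (meson mult_le_mono2 order.trans)
    finally show "length (queries G t') \<le> m * K + M * q" by simp
    show "set (queries G t') \<subseteq> signed T \<times> {1..n}"
      unfolding t' by (rule set_queries_foldr_check_at[OF G R xs(2) sim(3)])
  qed
  then show "\<exists>q A. is_tester T E2 \<epsilon> q A" by blast
qed

section \<open>From an isomorphism to rewriting words\<close>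

text \<open>The words \<open>v s\<close> and \<open>u t\<close> are arbitrary representatives of the
  images of generators under the isomorphism and its inverse; that both maps are homomorphisms makes
  the pullbacks preserve solutions.\<close>

lemma testable_iso:
  assumes fin: "finite S" "finite T"
    and E1: "relation_system S E1" and E2: "relation_system T E2"
    and iso: "presented_group S E1 \<cong> presented_group T E2"
    and test: "testable S E1"
  shows "testable T E2"
proof -
  let ?G1 = "presented_group S E1" and ?G2 = "presented_group T E2"
  obtain h where h: "h \<in> iso ?G1 ?G2" using iso by (auto simp: is_iso_def)
  define g where "g = inv_into (carrier ?G1) h"
  have g: "g \<in> iso ?G2 ?G1"
    unfolding g_def by (rule group.iso_set_sym[OF group_presented_group[OF E1] h])
  have homs: "h \<in> hom ?G1 ?G2" "g \<in> hom ?G2 ?G1"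
    using h g by (auto simp: iso_def)
  have hg: "h (g y) = y" if "y \<in> carrier ?G2" for y
    using h that by (auto simp: g_def iso_def bij_betw_def f_inv_into_f)
  have "\<exists>w\<in>lists (signed T). h (word_class S E1 [Pos s]) = word_class T E2 w" if "s \<in> S" for s
  proof -
    have "word_class S E1 [Pos s] \<in> carrier ?G1"
      unfolding carrier_presented_group using that by (intro imageI) (auto simp: signed_def)
    then have "h (word_class S E1 [Pos s]) \<in> carrier ?G2" using homs(1) by (auto simp: hom_def)
    then show ?thesis unfolding carrier_presented_group by blast
  qed
  then obtain v where v: "\<And>s. s \<in> S \<Longrightarrow> v s \<in> lists (signed T)"
    and hv: "\<And>s. s \<in> S \<Longrightarrow> h (word_class S E1 [Pos s]) = word_class T E2 (v s)"
    by metis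
  have t_carrier: "word_class T E2 [Pos t] \<in> carrier ?G2" if "t \<in> T" for t
    unfolding carrier_presented_group using that by (intro imageI) (auto simp: signed_def)
  have "\<exists>w\<in>lists (signed S). g (word_class T E2 [Pos t]) = word_class S E1 w" if "t \<in> T" for t
  proof -
    have "g (word_class T E2 [Pos t]) \<in> carrier ?G1"
      using t_carrier[OF that] homs(2) by (auto simp: hom_def)
    then show ?thesis unfolding carrier_presented_group by blast
  qed
  then obtain u where u: "\<And>t. t \<in> T \<Longrightarrow> u t \<in> lists (signed S)"
    and gu: "\<And>t. t \<in> T \<Longrightarrow> g (word_class T E2 [Pos t]) = word_class S E1 (u t)"
    by metis
  have v': "v \<in> S \<rightarrow> lists (signed T)" and u': "u \<in> T \<rightarrow> lists (signed S)"
    using v u by blast+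
  show ?thesis
  proof (rule testable_transfer[OF fin v' u' _ _ _ test])
    fix n G t assume G: "G \<in> GSol T E2 n" and t: "t \<in> T"
    \<comment> \<open>The round trip of \<open>t\<close> has class \<open>h (g [t]) = [t]\<close>,
      writing \<open>[t]\<close> for the class of the generator; so on solutions it acts as
      \<open>t\<close> itself.\<close>
    have "word_class T E2 (subst_word v (u t)) = h (word_class S E1 (u t))"
      using hom_word_class[OF E1 E2 homs(1) v' hv u[OF t]] by simp
    also have "\<dots> = word_class T E2 [Pos t]"
      using hg[OF t_carrier[OF t]] gu[OF t] by simp
    finally have "word_act G (subst_word v (u t)) = word_act G [Pos t]"
      using t subst_word_in_lists[OF v' u[OF t]]
      by (intro word_act_cong_word_class[OF E2 G]) (auto simp: signed_def)
    then show "word_act G (subst_word v (u t)) = G t" by (simp add: letter_act_Pos)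
  qed (use pullback_in_GSol[OF E1 E2 homs(1) v' hv] pullback_in_GSol[OF E2 E1 homs(2) u' gu] in blast)+
qed

theorem proposition3p2:
  fixes S :: "'a set" and T :: "'b set"
    and E1 :: "'a relsys" and E2 :: "'b relsys"
  assumes "finite S" and "finite T"
    and "relation_system S E1" and "relation_system T E2"
    and "presented_group S E1 \<cong> presented_group T E2"
  shows "testable S E1 \<longleftrightarrow> testable T E2"
  \<comment> \<open>Isomorphism is symmetric, so the one-sided transfer applies in both
    directions.\<close>
  using testable_iso[OF assms] testable_iso[OF assms(2,1,4,3)]
    group.iso_sym[OF group_presented_group[OF assms(3)] assms(5)]
  by blast

end
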